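(* Let $\mathbf S=(S;\wedge,\vee,1)$ be a co-strongly distributive skew lattice with top $1$. Then $\mathbf S$ is the reduct of a uniquely determined skew Heyting algebra $(S;\wedge,\vee,\rightarrow,1)$ if any one of the following conditions holds: (1) $S/\mathcal D$ is finite; (2) $\mathbf S$ is a skew chain; (3) $\mathbf S$ is the reduct of a dual skew Boolean algebra $(S;\wedge,\vee,\setminus\!\setminus,1)$.
   Context: A skew lattice is an algebra $(S;\wedge,\vee)$ of type $(2,2)$ in which $\wedge$ and $\vee$ are idempotent and associative and satisfy $x\wedge(x\vee y)=x=x\vee(x\wedge y)$ and $(x\wedge y)\vee y=y=(x\vee y)\wedge y$. Its natural partial order is: $x\le y$ iff $x\vee y=y=y\vee x$. Its natural preorder is: $x\preceq y$ iff $y\vee x\vee y=y$ (equivalently $x\wedge y\wedge x=x$). Green's relation $\mathcal D$ is: $x\mathrel{\mathcal D}y$ iff $x\preceq y$ and $y\preceq x$. It is known that $\mathcal D$ is a congruence on any skew lattice $S$ and that $S/\mathcal D$ is a lattice. A skew chain is a skew lattice $S$ such that $S/\mathcal D$ is a chain, i.e. $\preceq$ is a total preorder. A skew lattice with top is $(S;\wedge,\vee,1)$ with $x\vee 1=1=1\vee x$ for all $x$. A skew lattice is co-strongly distributive if $x\vee(y\wedge z)=(x\vee y)\wedge(x\vee z)$ and $(x\wedge y)\vee z=(x\vee z)\wedge(y\vee z)$ for all $x,y,z$. For $u\in S$ put $u{\uparrow}=\{x\in S: u\le x\}$; if $S$ is co-strongly distributive with top $1$, then $u{\uparrow}$ is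 closed under $\wedge,\vee$ and is a (commutative) bounded distributive lattice with bottom $u$ and top $1$. A dual skew Boolean algebra is an algebra $(S;\wedge,\vee,\setminus\!\setminus,1)$ such that $(S;\wedge,\vee,1)$ is a co-strongly distributive skew lattice with top $1$ and $\setminus\!\setminus$ is a binary operation satisfying, for all $x,y$, $(y\vee x\vee y)\vee(y\setminus\!\setminus x)=1=(y\setminus\!\setminus x)\vee(y\vee x\vee y)$ and $(y\vee x\vee y)\wedge(y\setminus\!\setminus x)=y=(y\setminus\!\setminus x)\wedge(y\vee x\vee y)$. A Heyting algebra is a bounded distributive lattice with a binary operation $\rightarrow$ such that $x\wedge y\le z$ iff $x\le y\rightarrow z$. A skew Heyting lattice is a co-strongly distributive skew lattice $(S;\wedge,\vee,1)$ with top $1$ such that for each $u\in S$ there is an operation $\rightarrow_u$ on $u{\uparrow}$ making $(u{\uparrow};\wedge,\vee,\rightarrow_u,1,u)$ a Heyting algebra (such $\rightarrow_u$ is unique). A skew Heyting algebra is an algebra $(S;\wedge,\vee,\rightarrow,1)$ of type $(2,2,2,0)$ such that $(S;\wedge,\vee,1)$ is a skew Heyting lattice and $x\rightarrow y=(y\vee x\vee y)\rightarrow_y y$ for all $x,y\in S$. *)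

theory Defs
  imports Main
begin

text \<open>
  The underlying set of a skew lattice is the type \<open>'a\<close>.  Heyting algebras are defined on a carrier
  set, since they occur on the subsets \<open>u\<up>\<close> of a skew lattice.
\<close>

definition natural_le :: "('a \<Rightarrow> 'a \<Rightarrow> 'a) \<Rightarrow> 'a \<Rightarrow> 'a \<Rightarrow> bool" where
  "natural_le join x y \<longleftrightarrow> join x y = y \<and> join y x = y"

definition natural_preorder :: "('a \<Rightarrow> 'a \<Rightarrow> 'a) \<Rightarrow> 'a \<Rightarrow> 'a \<Rightarrow> bool" where
  "natural_preorder join x y \<longleftrightarrow> join (join y x) y = y"

definition green_D :: "('a \<Rightarrow> 'a \<Rightarrow> 'a) \<Rightarrow> ('a \<times> 'a) set" where
  "green_D join = {(x, y). natural_preorder join x y \<and> natural_preorder join y x}"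

definition upset :: "('a \<Rightarrow> 'a \<Rightarrow> 'a) \<Rightarrow> 'a \<Rightarrow> 'a set" where
  "upset join u = {x. natural_le join u x}"

locale skew_lattice =
  fixes meet :: "'a \<Rightarrow> 'a \<Rightarrow> 'a" (infixl \<open>\<sqinter>\<close> 70)
    and join :: "'a \<Rightarrow> 'a \<Rightarrow> 'a" (infixl \<open>\<squnion>\<close> 65)
  assumes meet_idem: "x \<sqinter> x = x"
    and join_idem: "x \<squnion> x = x"
    and meet_assoc: "(x \<sqinter> y) \<sqinter> z = x \<sqinter> (y \<sqinter> z)"
    and join_assoc: "(x \<squnion> y) \<squnion> z = x \<squnion> (y \<squnion> z)"
    and absorb1: "x \<sqinter> (x \<squnion> y) = x"
    and absorb2: "x \<squnion> (x \<sqinter> y) = x"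
    and absorb3: "(x \<sqinter> y) \<squnion> y = y"
    and absorb4: "(x \<squnion> y) \<sqinter> y = y"

text \<open>
  Totality of the natural preorder says that \<open>S/\<D>\<close> is a chain; reflexivity and transitivity
  hold in every skew lattice.
\<close>

locale skew_chain = skew_lattice +
  assumes total: "natural_preorder join x y \<or> natural_preorder join y x"

locale skew_lattice_top = skew_lattice +
  fixes top :: 'a (\<open>\<one>\<close>)
  assumes join_top: "x \<squnion> \<one> = \<one>"
    and top_join: "\<one> \<squnion> x = \<one>"

locale co_strongly_distributive_skew_lattice_top = skew_lattice_top +
  assumes join_meet_distrib_left: "x \<squnion> (y \<sqinter> z) = (x \<squnion> y) \<sqinter> (x \<squnion> z)"
    and join_meet_distrib_right: "(x \<sqinter> y) \<squnion> z = (x \<squnion> z) \<sqinter> (y \<squnion> z)"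

locale dual_skew_boolean_algebra = co_strongly_distributive_skew_lattice_top +
  fixes diff :: "'a \<Rightarrow> 'a \<Rightarrow> 'a" (infixl \<open>\<setminus>\<close> 65)
  assumes "(y \<squnion> x \<squnion> y) \<squnion> (y \<setminus> x) = \<one>"
    and "(y \<setminus> x) \<squnion> (y \<squnion> x \<squnion> y) = \<one>"
    and "(y \<squnion> x \<squnion> y) \<sqinter> (y \<setminus> x) = y"
    and "(y \<setminus> x) \<sqinter> (y \<squnion> x \<squnion> y) = y"

locale bounded_distributive_lattice_on =
  fixes A :: "'a set"
    and meet :: "'a \<Rightarrow> 'a \<Rightarrow> 'a" (infixl \<open>\<sqinter>\<close> 70)
    and join :: "'a \<Rightarrow> 'a \<Rightarrow> 'a" (infixl \<open>\<squnion>\<close> 65)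
    and top :: 'a (\<open>\<one>\<close>)
    and bot :: 'a (\<open>\<zero>\<close>)
  assumes meet_closed: "\<lbrakk>x \<in> A; y \<in> A\<rbrakk> \<Longrightarrow> x \<sqinter> y \<in> A"
    and join_closed: "\<lbrakk>x \<in> A; y \<in> A\<rbrakk> \<Longrightarrow> x \<squnion> y \<in> A"
    and top_closed: "\<one> \<in> A"
    and bot_closed: "\<zero> \<in> A"
    and meet_assoc: "\<lbrakk>x \<in> A; y \<in> A; z \<in> A\<rbrakk> \<Longrightarrow> (x \<sqinter> y) \<sqinter> z = x \<sqinter> (y \<sqinter> z)"
    and join_assoc: "\<lbrakk>x \<in> A; y \<in> A; z \<in> A\<rbrakk> \<Longrightarrow> (x \<squnion> y) \<squnion> z = x \<squnion> (y \<squnion> z)"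
    and meet_commute: "\<lbrakk>x \<in> A; y \<in> A\<rbrakk> \<Longrightarrow> x \<sqinter> y = y \<sqinter> x"
    and join_commute: "\<lbrakk>x \<in> A; y \<in> A\<rbrakk> \<Longrightarrow> x \<squnion> y = y \<squnion> x"
    and meet_join_absorb: "\<lbrakk>x \<in> A; y \<in> A\<rbrakk> \<Longrightarrow> x \<sqinter> (x \<squnion> y) = x"
    and join_meet_absorb: "\<lbrakk>x \<in> A; y \<in> A\<rbrakk> \<Longrightarrow> x \<squnion> (x \<sqinter> y) = x"
    and meet_join_distrib:
      "\<lbrakk>x \<in> A; y \<in> A; z \<in> A\<rbrakk> \<Longrightarrow> x \<sqinter> (y \<squnion> z) = (x \<sqinter> y) \<squnion> (x \<sqinter> z)"
    and top_greatest: "x \<in> A \<Longrightarrow> natural_le join x \<one>"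
    and bot_least: "x \<in> A \<Longrightarrow> natural_le join \<zero> x"

locale heyting_algebra_on = bounded_distributive_lattice_on A meet join top bot
  for A :: "'a set"
    and meet :: "'a \<Rightarrow> 'a \<Rightarrow> 'a" (infixl \<open>\<sqinter>\<close> 70)
    and join :: "'a \<Rightarrow> 'a \<Rightarrow> 'a" (infixl \<open>\<squnion>\<close> 65)
    and imp :: "'a \<Rightarrow> 'a \<Rightarrow> 'a" (infixr \<open>\<rightarrow>\<close> 60)
    and top :: 'a (\<open>\<one>\<close>)
    and bot :: 'a (\<open>\<zero>\<close>) +
  assumes imp_closed: "\<lbrakk>x \<in> A; y \<in> A\<rbrakk> \<Longrightarrow> x \<rightarrow> y \<in> A"
    and residuation: "\<lbrakk>x \<in> A; y \<in> A; z \<in> A\<rbrakk> \<Longrightarrow>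
      natural_le join (x \<sqinter> y) z \<longleftrightarrow> natural_le join x (y \<rightarrow> z)"

locale skew_heyting_lattice = co_strongly_distributive_skew_lattice_top +
  assumes upset_heyting: "\<exists>h. heyting_algebra_on (upset join u) (\<sqinter>) (\<squnion>) h \<one> u"

text \<open>
  In the axiom below, \<open>h\<close> is the operation \<open>\<rightarrow>\<^sub>y\<close>.  Its values on \<open>y\<up>\<close> are unique, and it is
  only applied to the elements \<open>y \<squnion> x \<squnion> y\<close> and \<open>y\<close> of \<open>y\<up>\<close>.
\<close>

locale skew_heyting_algebra = skew_heyting_lattice meet join top
  for meet :: "'a \<Rightarrow> 'a \<Rightarrow> 'a" (infixl \<open>\<sqinter>\<close> 70)
    and join :: "'a \<Rightarrow> 'a \<Rightarrow> 'a" (infixl \<open>\<squnion>\<close> 65)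
    and imp :: "'a \<Rightarrow> 'a \<Rightarrow> 'a" (infixr \<open>\<rightarrow>\<close> 60)
    and top :: 'a (\<open>\<one>\<close>) +
  assumes imp_eq: "\<exists>h. heyting_algebra_on (upset join y) (\<sqinter>) (\<squnion>) h \<one> y \<and>
      (\<forall>x. x \<rightarrow> y = h (y \<squnion> x \<squnion> y) y)"

end

theory Submission
  imports Defs
begin

text \<open>
  For \<open>a, b \<in> u\<up>\<close>, co-strong distributivity gives \<open>a = a \<squnion> (b \<sqinter> u) = (a \<squnion> b) \<sqinter> a\<close>, that is,
  \<open>a \<squnion> b \<squnion> a = a \<squnion> b\<close>; by symmetry \<open>a \<squnion> b \<squnion> a = b \<squnion> a\<close>.  Hence \<open>u\<up>\<close> is commutative, so a
  bounded distributive lattice, and it embeds into \<open>S/\<D>\<close>.  It is therefore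
  finite in case (1), a chain in case (2), and complemented by \<open>x \<mapsto> u \<setminus> x\<close> in case (3); each of
  these properties makes a bounded distributive lattice a Heyting algebra.  As the operations
  \<open>\<rightarrow>\<^sub>u\<close> are determined by the order, so is the global implication.
\<close>

section \<open>Order facts in a bounded distributive lattice on a carrier set\<close>

context bounded_distributive_lattice_on
begin

lemma le_iff_join:
  "\<lbrakk>x \<in> A; y \<in> A\<rbrakk> \<Longrightarrow> natural_le join x y \<longleftrightarrow> x \<squnion> y = y"
  using join_commute[of x y] by (simp add: natural_le_def)

lemma le_iff_meet:
  assumes "x \<in> A" "y \<in> A"
  shows "natural_le join x y \<longleftrightarrow> x \<sqinter> y = x"
  using assms join_meet_absorb[of y x] meet_join_absorb[of x y] meet_commute[of x y]
    join_commute[of x y] by (auto simp: le_iff_join)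

lemma le_antisym:
  "\<lbrakk>x \<in> A; y \<in> A; natural_le join x y; natural_le join y x\<rbrakk> \<Longrightarrow> x = y"
  by (simp add: natural_le_def)

lemma le_trans:
  assumes "x \<in> A" "y \<in> A" "z \<in> A" "natural_le join x y" "natural_le join y z"
  shows "natural_le join x z"
  using assms join_assoc[of x y z] by (simp add: le_iff_join)

text \<open>The two absorption laws together force \<open>x \<squnion> x = x\<close>, which is what
  reflexivity amounts to.\<close>

lemma le_refl: "x \<in> A \<Longrightarrow> natural_le join x x"
  using join_meet_absorb[of x "x \<squnion> x"] meet_join_absorb[of x x]
  by (simp add: le_iff_join join_closed)

lemma le_join1: "\<lbrakk>x \<in> A; y \<in> A\<rbrakk> \<Longrightarrow> natural_le join x (x \<squnion> y)"
  by (simp add: le_iff_meet join_closed meet_join_absorb)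

lemma le_join2: "\<lbrakk>x \<in> A; y \<in> A\<rbrakk> \<Longrightarrow> natural_le join y (x \<squnion> y)"
  using le_join1[of y x] by (simp add: join_commute)

lemma join_le_iff:
  assumes "x \<in> A" "y \<in> A" "z \<in> A"
  shows "natural_le join (x \<squnion> y) z \<longleftrightarrow> natural_le join x z \<and> natural_le join y z"
proof
  assume *: "natural_le join (x \<squnion> y) z"
  show "natural_le join x z \<and> natural_le join y z"
    using le_trans[OF _ _ _ le_join1 *] le_trans[OF _ _ _ le_join2 *] assms
    by (simp add: join_closed)
next
  assume "natural_le join x z \<and> natural_le join y z"
  then show "natural_le join (x \<squnion> y) z"
    using assms join_assoc[of x y z] by (simp add: le_iff_join join_closed)
qed

lemma meet_le1: "\<lbrakk>x \<in> A; y \<in> A\<rbrakk> \<Longrightarrow> natural_le join (x \<sqinter> y) x"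
  using join_meet_absorb[of x y] by (simp add: le_iff_join meet_closed join_commute)

lemma meet_le2: "\<lbrakk>x \<in> A; y \<in> A\<rbrakk> \<Longrightarrow> natural_le join (x \<sqinter> y) y"
  using meet_le1[of y x] by (simp add: meet_commute)

lemma meet_mono_left:
  assumes "x \<in> A" "y \<in> A" "z \<in> A" "natural_le join x y"
  shows "natural_le join (x \<sqinter> z) (y \<sqinter> z)"
  using assms meet_join_distrib[of z x y]
  by (simp add: le_iff_join meet_closed meet_commute[of _ z])

section \<open>Criteria for a Heyting algebra\<close>

lemma heyting_algebra_onI:
  assumes "\<And>y z. \<lbrakk>y \<in> A; z \<in> A\<rbrakk> \<Longrightarrow>
    \<exists>w\<in>A. \<forall>x\<in>A. natural_le join (x \<sqinter> y) z \<longleftrightarrow> natural_le join x w"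
  shows "\<exists>h. heyting_algebra_on A (\<sqinter>) (\<squnion>) h \<one> \<zero>"
proof -
  \<comment> \<open>Choice turns the pointwise witnesses into one operation, constrained only on
    \<open>A\<close>.\<close>
  obtain h where "\<And>y z. \<lbrakk>y \<in> A; z \<in> A\<rbrakk> \<Longrightarrow>
      h y z \<in> A \<and> (\<forall>x\<in>A. natural_le join (x \<sqinter> y) z \<longleftrightarrow> natural_le join x (h y z))"
    using assms by metis
  then have "heyting_algebra_on A (\<sqinter>) (\<squnion>) h \<one> \<zero>"
    by unfold_locales auto
  then show ?thesis by blast
qed

text \<open>The join-closed set \<open>C\<close> stays fixed while the induction runs over
  \<open>B\<close>. With \<open>B = C\<close>, the bound found inside \<open>C\<close> is its
  greatest element.\<close>

lemma finite_upper_bound: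
  assumes "finite B" "B \<subseteq> C" "C \<subseteq> A" "\<zero> \<in> C"
    and "\<And>x y. \<lbrakk>x \<in> C; y \<in> C\<rbrakk> \<Longrightarrow> x \<squnion> y \<in> C"
  shows "\<exists>w\<in>C. \<forall>x\<in>B. natural_le join x w"
  using assms(1,2)
proof (induction B)
  case empty
  then show ?case using assms(4) by auto
next
  case (insert b B)
  then obtain w where w: "w \<in> C" "\<forall>x\<in>B. natural_le join x w" by auto
  have bw: "b \<squnion> w \<in> C" "b \<in> A" "w \<in> A" "B \<subseteq> A" using insert.prems w assms(3,5) by auto
  then have "natural_le join b (b \<squnion> w)" "natural_le join w (b \<squnion> w)"
    by (simp_all add: le_join1 le_join2)
  with w bw show ?case
    by (intro bexI[of _ "b \<squnion> w"]) (auto intro: le_trans[of _ w] join_closed)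
qed

text \<open>The implication from \<open>y\<close> to \<open>z\<close> has to be the greatest
  \<open>x\<close> with \<open>x \<sqinter> y\<close> below \<open>z\<close>. These \<open>x\<close>
  include \<open>\<zero>\<close> and, by distributivity, are closed under joins, so finiteness
  yields a greatest one.\<close>

lemma heyting_if_finite:
  assumes "finite A"
  shows "\<exists>h. heyting_algebra_on A (\<sqinter>) (\<squnion>) h \<one> \<zero>"
proof (rule heyting_algebra_onI)
  fix y z assume yz: "y \<in> A" "z \<in> A"
  let ?C = "{x \<in> A. natural_le join (x \<sqinter> y) z}"
  have "\<zero> \<in> ?C"
    using yz bot_closed bot_least[of z] bot_least[of y] by (simp add: le_iff_meet)
  moreover have "x \<squnion> x' \<in> ?C" if "x \<in> ?C" "x' \<in> ?C" for x x'
  proof -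
    have "(x \<squnion> x') \<sqinter> y = (x \<sqinter> y) \<squnion> (x' \<sqinter> y)"
      using that yz meet_join_distrib[of y x x'] by (simp add: meet_commute join_closed)
    then show ?thesis using that yz by (simp add: join_closed meet_closed join_le_iff)
  qed
  ultimately obtain w where w: "w \<in> ?C" "\<forall>x\<in>?C. natural_le join x w"
    using finite_upper_bound[of ?C ?C] assms by auto
  have "natural_le join (x \<sqinter> y) z \<longleftrightarrow> natural_le join x w" if "x \<in> A" for x
  proof
    assume "natural_le join (x \<sqinter> y) z"
    then show "natural_le join x w" using w that by simp
  next
    assume "natural_le join x w"
    then have "natural_le join (x \<sqinter> y) (w \<sqinter> y)" using that w yz by (simp add: meet_mono_left)
    then show "natural_le join (x \<sqinter> y) z"
      using le_trans[of "x \<sqinter> y" "w \<sqinter> y" z] that w yz by (simp add: meet_closed)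
  qed
  with w show "\<exists>w\<in>A. \<forall>x\<in>A. natural_le join (x \<sqinter> y) z \<longleftrightarrow> natural_le join x w" by blast
qed

text \<open>The witness is the Goedel implication: \<open>\<one>\<close> if \<open>y\<close> is
  below \<open>z\<close>, and \<open>z\<close> otherwise.\<close>

lemma heyting_if_chain:
  assumes total: "\<And>x y. \<lbrakk>x \<in> A; y \<in> A\<rbrakk> \<Longrightarrow> natural_le join x y \<or> natural_le join y x"
  shows "\<exists>h. heyting_algebra_on A (\<sqinter>) (\<squnion>) h \<one> \<zero>"
proof (rule heyting_algebra_onI)
  fix y z assume yz: "y \<in> A" "z \<in> A"
  show "\<exists>w\<in>A. \<forall>x\<in>A. natural_le join (x \<sqinter> y) z \<longleftrightarrow> natural_le join x w"
  proof (cases "natural_le join y z")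
    case True
    then have "\<forall>x\<in>A. natural_le join (x \<sqinter> y) z \<longleftrightarrow> natural_le join x \<one>"
      using yz le_trans[OF _ _ _ meet_le2 True] by (simp add: top_greatest meet_closed)
    then show ?thesis using top_closed by blast
  next
    case False
    have "natural_le join (x \<sqinter> y) z \<longleftrightarrow> natural_le join x z" if "x \<in> A" for x
    proof
      assume *: "natural_le join (x \<sqinter> y) z"
      \<comment> \<open>Thus \<open>y\<close> is not below \<open>x\<close>; totality puts
        \<open>x\<close> below \<open>y\<close>, so that \<open>x \<sqinter> y\<close> is just
        \<open>x\<close>.\<close>
      then have "x \<sqinter> y \<noteq> y" using False by auto
      then have "natural_le join x y"
        using total[OF that yz(1)] that yz by (auto simp: le_iff_meet meet_commute)
      with * show "natural_le join x z" using that yz by (simp add: le_iff_meet)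
    next
      assume *: "natural_le join x z"
      show "natural_le join (x \<sqinter> y) z"
        using that yz le_trans[OF _ _ _ meet_le1 *] by (simp add: meet_closed)
    qed
    then show ?thesis using yz by blast
  qed
qed

text \<open>As in a Boolean algebra, the implication from \<open>y\<close> to \<open>z\<close> is
  \<open>c \<squnion> z\<close> with \<open>c\<close> a complement of \<open>y\<close>.\<close>

lemma heyting_if_complemented:
  assumes compl: "\<And>y. y \<in> A \<Longrightarrow> \<exists>c\<in>A. y \<squnion> c = \<one> \<and> y \<sqinter> c = \<zero>"
  shows "\<exists>h. heyting_algebra_on A (\<sqinter>) (\<squnion>) h \<one> \<zero>"
proof (rule heyting_algebra_onI)
  fix y z assume yz: "y \<in> A" "z \<in> A"
  obtain c where c: "c \<in> A" "y \<squnion> c = \<one>" "y \<sqinter> c = \<zero>" using compl yz by blast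
  have "natural_le join (x \<sqinter> y) z \<longleftrightarrow> natural_le join x (c \<squnion> z)" if x: "x \<in> A" for x
  proof
    assume *: "natural_le join (x \<sqinter> y) z"
    have cz: "natural_le join c (c \<squnion> z)" "natural_le join z (c \<squnion> z)"
      using c yz by (simp_all add: le_join1 le_join2)
    \<comment> \<open>Distributes \<open>x \<sqinter> \<one>\<close> using
      \<open>\<one> = y \<squnion> c\<close>; each of the two parts is then bounded by
      \<open>c \<squnion> z\<close>.\<close>
    have "x = (x \<sqinter> y) \<squnion> (x \<sqinter> c)"
      using meet_join_distrib[of x y c] c x yz top_greatest[of x] top_closed
      by (simp add: le_iff_meet)
    moreover have "natural_le join (x \<sqinter> y) (c \<squnion> z)"
      using le_trans[OF _ _ _ * cz(2)] c x yz by (simp add: meet_closed join_closed)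
    moreover have "natural_le join (x \<sqinter> c) (c \<squnion> z)"
      using le_trans[OF _ _ _ meet_le2 cz(1)] c x yz by (simp add: meet_closed join_closed)
    ultimately show "natural_le join x (c \<squnion> z)"
      using c x yz join_le_iff[of "x \<sqinter> y" "x \<sqinter> c" "c \<squnion> z"]
      by (simp add: meet_closed join_closed)
  next
    assume "natural_le join x (c \<squnion> z)"
    then have "natural_le join (x \<sqinter> y) ((c \<squnion> z) \<sqinter> y)"
      using c x yz by (simp add: meet_mono_left join_closed)
    moreover have "(c \<squnion> z) \<sqinter> y = \<zero> \<squnion> (y \<sqinter> z)"
      using meet_join_distrib[of y c z] c yz by (simp add: meet_commute[of _ y] join_closed)
    moreover have "\<zero> \<squnion> (y \<sqinter> z) = y \<sqinter> z"
      using bot_least[of "y \<sqinter> z"] yz by (simp add: natural_le_def meet_closed)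
    ultimately show "natural_le join (x \<sqinter> y) z"
      using le_trans[of "x \<sqinter> y" "y \<sqinter> z" z] meet_le2[of y z] x yz by (simp add: meet_closed)
  qed
  then show "\<exists>w\<in>A. \<forall>x\<in>A. natural_le join (x \<sqinter> y) z \<longleftrightarrow> natural_le join x w"
    using c yz join_closed by blast
qed

end

text \<open>Residuation for \<open>h\<close> at \<open>x = h y z\<close> gives
  \<open>h y z \<sqinter> y\<close> below \<open>z\<close>; residuation for \<open>h'\<close> then
  puts \<open>h y z\<close> below \<open>h' y z\<close>. Symmetry and antisymmetry finish.\<close>

lemma heyting_imp_unique:
  assumes "heyting_algebra_on A meet join h t b" "heyting_algebra_on A meet join h' t b"
    and "y \<in> A" "z \<in> A"
  shows "h y z = h' y z"
proof -
  interpret h: heyting_algebra_on A meet join h t b by fact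
  interpret h': heyting_algebra_on A meet join h' t b by fact
  note closed = h.imp_closed[OF assms(3,4)] h'.imp_closed[OF assms(3,4)]
  have "natural_le join (h y z) (h' y z)"
    using h.residuation[of "h y z" y z] h'.residuation[of "h y z" y z] closed assms(3,4)
    by (simp add: h.le_refl)
  moreover have "natural_le join (h' y z) (h y z)"
    using h.residuation[of "h' y z" y z] h'.residuation[of "h' y z" y z] closed assms(3,4)
    by (simp add: h.le_refl)
  ultimately show ?thesis by (rule h.le_antisym[OF closed])
qed

section \<open>Upsets as commutative distributive lattices\<close>

context skew_lattice
begin

lemma join_left_idem: "x \<squnion> (x \<squnion> y) = x \<squnion> y"
  by (simp add: join_assoc[symmetric] join_idem)

text \<open>The sandwich carries an arbitrary \<open>x\<close> into the upset of \<open>y\<close>,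
  where the local implication can be applied to it.\<close>

lemma upset_sandwich: "y \<squnion> x \<squnion> y \<in> upset join y"
  by (simp add: upset_def natural_le_def join_assoc join_idem join_left_idem)

lemma upset_meet: "x \<in> upset join u \<Longrightarrow> u \<sqinter> x = u \<and> x \<sqinter> u = u"
  using absorb1[of u x] absorb4[of x u] by (simp add: upset_def natural_le_def)

end

context co_strongly_distributive_skew_lattice_top
begin

lemma upset_join_closed:
  "\<lbrakk>x \<in> upset join u; y \<in> upset join u\<rbrakk> \<Longrightarrow> x \<squnion> y \<in> upset join u"
  by (simp add: upset_def natural_le_def join_assoc) (simp add: join_assoc[symmetric])

lemma upset_meet_closed:
  "\<lbrakk>x \<in> upset join u; y \<in> upset join u\<rbrakk> \<Longrightarrow> x \<sqinter> y \<in> upset join u"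
  unfolding upset_def natural_le_def
  by (simp add: join_meet_distrib_left join_meet_distrib_right)

text \<open>The meet of \<open>b\<close> with the bottom \<open>u\<close> is \<open>u\<close>, and
  joining \<open>u\<close> to \<open>a\<close> gives \<open>a\<close>; so distributing
  \<open>a\<close> over that meet, on either side, yields absorption laws beyond the skew lattice
  axioms.\<close>

lemma upset_absorb:
  assumes "a \<in> upset join u" "b \<in> upset join u"
  shows "(a \<squnion> b) \<sqinter> a = a" "a \<sqinter> (b \<squnion> a) = a"
proof -
  have a: "a \<squnion> u = a" "u \<squnion> a = a" using assms(1) by (auto simp: upset_def natural_le_def)
  show "(a \<squnion> b) \<sqinter> a = a"
    using join_meet_distrib_left[of a b u] upset_meet[OF assms(2)] a by simp
  show "a \<sqinter> (b \<squnion> a) = a"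
    using join_meet_distrib_right[of u b a] upset_meet[OF assms(2)] a by simp
qed

lemma upset_join_commute:
  assumes "x \<in> upset join u" "y \<in> upset join u"
  shows "x \<squnion> y = y \<squnion> x"
proof -
  \<comment> \<open>Writing \<open>x\<close> as \<open>(x \<squnion> y) \<sqinter> x\<close> lets
    \<open>absorb2\<close> swallow it on the right; dually,
    \<open>x = x \<sqinter> (y \<squnion> x)\<close> is swallowed on the left by
    \<open>absorb3\<close>.\<close>
  have "x \<squnion> y \<squnion> x = x \<squnion> y"
    using absorb2[of "x \<squnion> y" x] upset_absorb(1)[OF assms] by simp
  moreover have "x \<squnion> (y \<squnion> x) = y \<squnion> x"
    using absorb3[of x "y \<squnion> x"] upset_absorb(2)[OF assms] by simp
  ultimately show ?thesis by (simp add: join_assoc)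
qed

lemma upset_meet_commute:
  assumes "x \<in> upset join u" "y \<in> upset join u"
  shows "x \<sqinter> y = y \<sqinter> x"
proof -
  \<comment> \<open>Commuting joins place \<open>a \<sqinter> b\<close> below both factors. Using
    this for both orders of the pair, \<open>b \<sqinter> a \<sqinter> b\<close> equals
    \<open>a \<sqinter> b\<close> as well as \<open>b \<sqinter> a\<close>.\<close>
  have *: "b \<sqinter> (a \<sqinter> b) = a \<sqinter> b \<and> (a \<sqinter> b) \<sqinter> a = a \<sqinter> b"
    if ab: "a \<in> upset join u" "b \<in> upset join u" for a b
  proof
    have "b \<squnion> (a \<sqinter> b) = b"
      using upset_join_commute[OF ab(2) upset_meet_closed[OF ab]] by (simp add: absorb3)
    then show "b \<sqinter> (a \<sqinter> b) = a \<sqinter> b" using absorb4[of b "a \<sqinter> b"] by simp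
    have "(a \<sqinter> b) \<squnion> a = a"
      using upset_join_commute[OF ab(1) upset_meet_closed[OF ab]] by (simp add: absorb2)
    then show "(a \<sqinter> b) \<sqinter> a = a \<sqinter> b" using absorb1[of "a \<sqinter> b" a] by simp
  qed
  show ?thesis using *[OF assms] *[OF assms(2,1)] by (simp add: meet_assoc)
qed

lemma upset_distributive_lattice:
  "bounded_distributive_lattice_on (upset join u) (\<sqinter>) (\<squnion>) \<one> u"
proof
  fix x y z assume xyz: "x \<in> upset join u" "y \<in> upset join u" "z \<in> upset join u"
  \<comment> \<open>Co-strong distributivity spreads joins over meets; the dual law follows by
    expanding the right-hand side and absorbing.\<close>
  have "(x \<sqinter> y) \<squnion> (x \<sqinter> z) = ((x \<sqinter> y) \<squnion> x) \<sqinter> ((x \<sqinter> y) \<squnion> z)"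
    by (rule join_meet_distrib_left)
  also have "(x \<sqinter> y) \<squnion> x = x"
    using upset_join_commute[OF upset_meet_closed[OF xyz(1,2)] xyz(1)] by (simp add: absorb2)
  also have "(x \<sqinter> y) \<squnion> z = (x \<squnion> z) \<sqinter> (y \<squnion> z)" by (rule join_meet_distrib_right)
  also have "x \<sqinter> ((x \<squnion> z) \<sqinter> (y \<squnion> z)) = x \<sqinter> (y \<squnion> z)"
    using meet_assoc[of x "x \<squnion> z"] by (simp add: absorb1)
  finally show "x \<sqinter> (y \<squnion> z) = (x \<sqinter> y) \<squnion> (x \<sqinter> z)" by simp
next
  fix x y assume xy: "x \<in> upset join u" "y \<in> upset join u"
  show "x \<squnion> y = y \<squnion> x" by (rule upset_join_commute[OF xy])
  show "x \<sqinter> y = y \<sqinter> x" by (rule upset_meet_commute[OF xy])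
  show "x \<squnion> y \<in> upset join u" by (rule upset_join_closed[OF xy])
  show "x \<sqinter> y \<in> upset join u" by (rule upset_meet_closed[OF xy])
qed (simp_all add: upset_def natural_le_def join_top top_join join_idem
    meet_assoc join_assoc absorb1 absorb2)

section \<open>Upsets compared with the quotient by \<D>\<close>

sublocale upset: bounded_distributive_lattice_on "upset join u" "(\<sqinter>)" "(\<squnion>)" \<one> u for u
  by (rule upset_distributive_lattice)

text \<open>Commutativity collapses the sandwich \<open>y \<squnion> x \<squnion> y\<close> to
  \<open>x \<squnion> y\<close>. This is how information about \<D> or totality of the preorder
  reaches the order of an upset.\<close>

lemma upset_preorder_imp_le:
  assumes "x \<in> upset join u" "y \<in> upset join u" "natural_preorder join x y"
  shows "natural_le join x y"
proof -
  have "y \<squnion> x \<squnion> y = x \<squnion> y"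
    using upset_join_commute[OF assms(1,2)] by (simp add: join_assoc join_idem join_left_idem)
  then show ?thesis
    using assms by (simp add: natural_preorder_def upset.le_iff_join)
qed

lemma upset_inj_green_D: "inj_on (\<lambda>x. green_D join `` {x}) (upset join u)"
proof (rule inj_onI)
  fix x y assume xy: "x \<in> upset join u" "y \<in> upset join u"
    and eq: "green_D join `` {x} = green_D join `` {y}"
  \<comment> \<open>Reflexivity of \<D> puts \<open>y\<close> in its own class, hence in that of
    \<open>x\<close>.\<close>
  have "y \<in> green_D join `` {y}"
    by (simp add: green_D_def natural_preorder_def join_idem)
  then have "y \<in> green_D join `` {x}" by (simp only: eq)
  then have "natural_preorder join x y" "natural_preorder join y x"
    by (simp_all add: green_D_def)
  then show "x = y"
    using upset.le_antisym[OF xy] upset_preorder_imp_le[OF xy]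
      upset_preorder_imp_le[OF xy(2,1)] by simp
qed

section \<open>Finite quotients and skew chains\<close>

lemma skew_heyting_if_finite:
  assumes "finite (UNIV // green_D join)"
  shows "skew_heyting_lattice (\<sqinter>) (\<squnion>) \<one>"
proof
  fix u
  have "(\<lambda>x. green_D join `` {x}) ` upset join u \<subseteq> UNIV // green_D join"
    by (auto intro: quotientI)
  then have "finite (upset join u)"
    using finite_imageD[OF finite_subset upset_inj_green_D] assms by simp
  then show "\<exists>h. heyting_algebra_on (upset join u) (\<sqinter>) (\<squnion>) h \<one> u"
    by (rule upset.heyting_if_finite)
qed

lemma skew_heyting_if_chain:
  assumes "skew_chain (\<sqinter>) (\<squnion>)"
  shows "skew_heyting_lattice (\<sqinter>) (\<squnion>) \<one>"
proof
  fix u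
  show "\<exists>h. heyting_algebra_on (upset join u) (\<sqinter>) (\<squnion>) h \<one> u"
  proof (rule upset.heyting_if_chain)
    fix x y assume "x \<in> upset join u" "y \<in> upset join u"
    then show "natural_le join x y \<or> natural_le join y x"
      using skew_chain.total[OF assms, of x y] upset_preorder_imp_le by blast
  qed
qed

section \<open>Existence and uniqueness of the global implication\<close>

lemma ex1_skew_heyting_algebra:
  assumes "skew_heyting_lattice (\<sqinter>) (\<squnion>) \<one>"
  shows "\<exists>!imp. skew_heyting_algebra (\<sqinter>) (\<squnion>) imp \<one>"
proof (rule ex_ex1I)
  interpret skew_heyting_lattice "(\<sqinter>)" "(\<squnion>)" \<one> by fact
  obtain h where h: "\<And>u. heyting_algebra_on (upset join u) (\<sqinter>) (\<squnion>) (h u) \<one> u"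
    using upset_heyting by metis
  have "skew_heyting_algebra (\<sqinter>) (\<squnion>) (\<lambda>x y. h y (y \<squnion> x \<squnion> y) y) \<one>"
    by unfold_locales (use h in blast)
  then show "\<exists>imp. skew_heyting_algebra (\<sqinter>) (\<squnion>) imp \<one>" by blast
next
  fix imp imp'
  assume imp: "skew_heyting_algebra (\<sqinter>) (\<squnion>) imp \<one>" "skew_heyting_algebra (\<sqinter>) (\<squnion>) imp' \<one>"
  show "imp = imp'"
  proof (intro ext)
    fix x y
    \<comment> \<open>The local operations \<open>h\<close> and \<open>h'\<close> may differ off the
      upset of \<open>y\<close>, but \<open>imp\<close> and \<open>imp'\<close> read them only at
      \<open>y \<squnion> x \<squnion> y\<close> and \<open>y\<close>, where they agree.\<close>
    obtain h where h: "heyting_algebra_on (upset join y) (\<sqinter>) (\<squnion>) h \<one> y"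
      "\<forall>x. imp x y = h (y \<squnion> x \<squnion> y) y"
      using skew_heyting_algebra.imp_eq[OF imp(1)] by blast
    obtain h' where h': "heyting_algebra_on (upset join y) (\<sqinter>) (\<squnion>) h' \<one> y"
      "\<forall>x. imp' x y = h' (y \<squnion> x \<squnion> y) y"
      using skew_heyting_algebra.imp_eq[OF imp(2)] by blast
    show "imp x y = imp' x y"
      using heyting_imp_unique[OF h(1) h'(1) upset_sandwich upset.bot_closed] h(2) h'(2) by simp
  qed
qed

end

section \<open>Dual skew Boolean algebras\<close>

context dual_skew_boolean_algebra
begin

lemma diff_complement:
  "(y \<squnion> x \<squnion> y) \<squnion> (y \<setminus> x) = \<one>"
  "(y \<squnion> x \<squnion> y) \<sqinter> (y \<setminus> x) = y"
  "(y \<setminus> x) \<sqinter> (y \<squnion> x \<squnion> y) = y"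
  using dual_skew_boolean_algebra_axioms
  by (simp_all add: dual_skew_boolean_algebra_def dual_skew_boolean_algebra_axioms_def)

lemma skew_heyting_lattice:
  "skew_heyting_lattice (\<sqinter>) (\<squnion>) \<one>"
proof
  fix u
  show "\<exists>h. heyting_algebra_on (upset join u) (\<sqinter>) (\<squnion>) h \<one> u"
  proof (rule upset.heyting_if_complemented)
    fix y assume "y \<in> upset join u"
    \<comment> \<open>On the upset of \<open>u\<close> the sandwich is trivial, so the laws for
      \<open>u \<setminus> y\<close> make it a complement of \<open>y\<close> itself.\<close>
    then have "u \<squnion> y \<squnion> u = y" by (simp add: upset_def natural_le_def)
    then have c: "y \<squnion> (u \<setminus> y) = \<one>" "y \<sqinter> (u \<setminus> y) = u" "(u \<setminus> y) \<sqinter> y = u"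
      using diff_complement[of u y] by simp_all
    \<comment> \<open>Since \<open>u\<close> is the meet of \<open>y\<close> and
      \<open>u \<setminus> y\<close> in either order, absorption gives both equations of the
      order.\<close>
    have "u \<setminus> y \<in> upset join u"
      using absorb3[of y "u \<setminus> y"] absorb2[of "u \<setminus> y" y] c
      by (simp add: upset_def natural_le_def)
    with c show "\<exists>c\<in>upset join u. y \<squnion> c = \<one> \<and> y \<sqinter> c = u" by blast
  qed
qed

end

theorem corollary3p8:
  fixes meet join :: "'a \<Rightarrow> 'a \<Rightarrow> 'a" and top :: 'a
  assumes "co_strongly_distributive_skew_lattice_top meet join top"
    and "finite (UNIV // green_D join)
      \<or> skew_chain meet join
      \<or> (\<exists>diff. dual_skew_boolean_algebra meet join top diff)"
  shows "\<exists>!imp. skew_heyting_algebra meet join imp top"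
proof -
  interpret co_strongly_distributive_skew_lattice_top meet join top by fact
  have "skew_heyting_lattice meet join top"
    using assms(2)
    by (elim disjE exE) (fact skew_heyting_if_finite skew_heyting_if_chain
      dual_skew_boolean_algebra.skew_heyting_lattice)+
  then show ?thesis by (rule ex1_skew_heyting_algebra)
qed

end
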